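(* Let $p\neq q$ be primes and $n$ a positive integer. Suppose $T$ is a numerical semigroup which is cyclotomic of depth $p^nq$ and height $1$. Then $T=\langle p^n,q\rangle$.
   Context: A numerical semigroup is a submonoid $T$ of $(\mathbb N,+)$ with $\mathbb N\setminus T$ finite; $\langle a,b\rangle$ denotes the submonoid generated by $a,b$. $\mathrm P_T(x)=(1-x)\sum_{t\in T}x^t$. $T$ is cyclotomic if $\mathrm P_T$ has all complex roots in the closed unit disc. $T$ is cyclotomic of depth $d$ and height $h$ if $\mathrm P_T(x)\mid (x^d-1)^h$ with $d,h$ chosen minimally, that is, $\mathrm P_T(x)$ does not divide $(x^m-1)^{h-1}$ for any $m$, and does not divide $(x^{d'}-1)^h$ for any divisor $d'<d$ of $d$. *)

theory Defs
  imports "HOL-Computational_Algebra.Computational_Algebra"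
begin

definition numerical_semigroup :: "nat set \<Rightarrow> bool" where
  "numerical_semigroup T \<longleftrightarrow>
     0 \<in> T \<and> (\<forall>a\<in>T. \<forall>b\<in>T. a + b \<in> T) \<and> finite (UNIV - T)"

definition gen2 :: "nat \<Rightarrow> nat \<Rightarrow> nat set" where
  "gen2 a b = {i * a + j * b | i j. True}"

definition semigroup_poly :: "nat set \<Rightarrow> int poly" where
  "semigroup_poly T = (THE p. fps_of_poly p =
      (1 - fps_X) * Abs_fps (\<lambda>n. if n \<in> T then 1 else 0))"

definition cyclotomic_depth_height :: "nat set \<Rightarrow> nat \<Rightarrow> nat \<Rightarrow> bool" where
  "cyclotomic_depth_height T d h \<longleftrightarrow>
     d \<ge> 1 \<and> h \<ge> 1 \<and>
     semigroup_poly T dvd (monom 1 d - 1) ^ h \<and>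
     (\<forall>m\<ge>1. \<not> semigroup_poly T dvd (monom 1 m - 1) ^ (h - 1)) \<and>
     (\<forall>d'. d' dvd d \<and> d' < d \<longrightarrow> \<not> semigroup_poly T dvd (monom 1 d' - 1) ^ h)"

end

theory Submission
  imports Defs
begin

text \<open>
  Let \<open>P\<close> be the semigroup polynomial. Roots of \<open>P\<close> are \<open>p ^ n * q\<close>-th roots of unity, and their
  set is closed under Galois conjugation. A root of prime power order would make a prime divide
  \<open>P(1) = 1\<close>, so \<open>P\<close> is a product of cyclotomic polynomials of index \<open>p ^ i * q\<close> with
  \<open>1 \<le> i \<le> n\<close>, and \<open>i = n\<close> occurs because the depth is minimal.
  The product over \<open>1 \<le> i \<le> k\<close> is the polynomial of the semigroup generated by \<open>p ^ k\<close> and \<open>q\<close>.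
  Suppose \<open>1, \<dots>, k\<close> occur, \<open>k + 1\<close> does not, and \<open>l + 1\<close> is the next index that occurs. With
  \<open>b = p ^ l\<close>, the Hilbert series of \<open>T\<close> agrees up to degree \<open>b\<close> with that of the semigroup
  generated by \<open>p ^ k\<close> and \<open>q\<close> times \<open>1 - x ^ b\<close>. Hence \<open>p ^ k\<close> lies in \<open>T\<close> but its multiple
  \<open>b\<close> does not, a contradiction.
\<close>

section \<open>Integer polynomials modulo \<open>x ^ d - 1\<close>\<close>

lemma map_poly_of_int_add:
  "map_poly of_int (f + g) = (map_poly of_int f + map_poly of_int g :: 'a::comm_ring_1 poly)"
  by (rule poly_eqI) (simp add: coeff_map_poly)

lemma map_poly_of_int_diff:
  "map_poly of_int (f - g) = (map_poly of_int f - map_poly of_int g :: 'a::comm_ring_1 poly)"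
  by (rule poly_eqI) (simp add: coeff_map_poly)

lemma map_poly_of_int_mult:
  "map_poly of_int (f * g) = (map_poly of_int f * map_poly of_int g :: 'a::comm_ring_1 poly)"
  by (rule poly_eqI) (simp add: coeff_map_poly coeff_mult)

lemma map_poly_of_int_sum:
  "map_poly of_int (\<Sum>i\<in>A. f i) = (\<Sum>i\<in>A. map_poly of_int (f i) :: 'a::comm_ring_1 poly)"
  by (induction A rule: infinite_finite_induct) (auto simp: map_poly_of_int_add)

lemmas map_poly_of_int_hom =
  map_poly_of_int_add map_poly_of_int_diff map_poly_of_int_mult map_poly_of_int_sum

text \<open>Translates a divisibility between \<open>P\<close> and
  \<open>pcompose P (monom 1 r)\<close> into a statement about the roots \<open>z\<close> and
  \<open>z ^ r\<close>.\<close>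

lemma poly_map_poly_pcompose_monom:
  "poly (map_poly of_int (pcompose f (monom 1 r))) (z::'a::comm_ring_1)
     = poly (map_poly of_int f) (z ^ r)"
  by (induction f)
     (simp_all add: pcompose_pCons map_poly_of_int_hom map_poly_pCons map_poly_monom poly_monom)

text \<open>A leading coefficient of absolute value 1 turns pseudo-division into integral division
  up to sign. Over the complex numbers \<open>g\<close> divides the remainder, whose degree is too
  small unless it vanishes. Divisibilities found by comparing complex roots descend to the integers
  this way.\<close>

lemma dvd_of_map_poly_dvd:
  fixes f g :: "int poly"
  assumes "\<bar>lead_coeff g\<bar> = 1"
    and "(map_poly of_int g :: complex poly) dvd map_poly of_int f"
  shows "g dvd f"
proof -
  have "g \<noteq> 0" using assms(1) by auto
  obtain q r where qr: "pseudo_divmod f g = (q, r)" by (metis surj_pair)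
  define c where "c = lead_coeff g ^ (Suc (degree f) - degree g)"
  have eq: "smult c f = g * q + r" and r: "r = 0 \<or> degree r < degree g"
    using pseudo_divmod[OF \<open>g \<noteq> 0\<close> qr] by (auto simp: c_def)
  \<comment> \<open>The scaling factor \<open>c\<close> is a power of a unit, so it is its own
    inverse.\<close>
  have "c * c = 1"
    using assms(1) by (simp add: c_def abs_if power_mult_distrib [symmetric] split: if_splits)
  have "[:c:] * f = g * q + r" using eq by simp
  hence "map_poly of_int r = map_poly of_int [:c:] * map_poly of_int f
            - map_poly of_int g * (map_poly of_int q :: complex poly)"
    by (metis map_poly_of_int_mult map_poly_of_int_diff add_diff_cancel_left')
  hence "(map_poly of_int g :: complex poly) dvd map_poly of_int r"
    using assms(2) by auto
  moreover have "degree (map_poly of_int h :: complex poly) = degree h" for h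
    by (rule degree_map_poly) auto
  ultimately have "map_poly of_int r = (0 :: complex poly) \<or> degree g \<le> degree r"
    using dvd_imp_degree_le by metis
  moreover have "map_poly of_int r = (0 :: complex poly) \<Longrightarrow> r = 0"
    by (subst (asm) map_poly_eq_0_iff) auto
  ultimately have "r = 0" using r by auto
  hence "f = g * smult c q" using eq \<open>c * c = 1\<close>
    by (metis add.right_neutral mult_smult_right smult_1_left smult_smult)
  thus ?thesis by (rule dvdI)
qed

text \<open>All inner binomial coefficients are divisible by \<open>r\<close>. The ring is general
  because both integers and integer polynomials are needed.\<close>

lemma prime_dvd_power_add:
  fixes x y :: "'a::comm_ring_1"
  assumes "prime r"
  shows "of_nat r dvd (x + y) ^ r - (x ^ r + y ^ r)"
proof -
  have "r > 0" using assms prime_gt_0_nat by auto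
  have "(x + y) ^ r = (\<Sum>k\<le>r. of_nat (r choose k) * x ^ k * y ^ (r - k))"
    by (rule binomial_ring)
  also have "{..r} = insert 0 (insert r {0<..<r})" using \<open>r > 0\<close> by auto
  finally have "(x + y) ^ r - (x ^ r + y ^ r)
      = (\<Sum>k\<in>{0<..<r}. of_nat (r choose k) * x ^ k * y ^ (r - k))"
    using \<open>r > 0\<close> by simp
  moreover have "of_nat r dvd of_nat (r choose k) * x ^ k * y ^ (r - k)" if "k \<in> {0<..<r}" for k
  proof -
    have "r dvd (r choose k)" using that assms by (intro dvd_choose_prime) auto
    hence "(of_nat r :: 'a) dvd of_nat (r choose k)" by (auto elim!: dvdE)
    thus ?thesis by (simp add: dvd_mult2)
  qed
  ultimately show ?thesis by (metis (no_types, lifting) dvd_sum)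
qed

text \<open>Fermat's little theorem, by induction from 0 in both directions.\<close>

lemma prime_dvd_power_minus_self_int:
  assumes "prime r"
  shows "int r dvd a ^ r - a"
proof (induction a rule: int_induct[where k = 0])
  case base
  show ?case using assms prime_gt_0_nat by (simp add: zero_power)
next
  case (step1 i)
  have "(i + 1) ^ r - (i + 1) = ((i + 1) ^ r - (i ^ r + 1 ^ r)) + (i ^ r - i)" by simp
  thus ?case using prime_dvd_power_add[OF assms, of i 1] step1(2) by (metis dvd_add of_nat_id)
next
  case (step2 i)
  have "(i - 1) ^ r - (i - 1) = (i ^ r - i) - (((i - 1) + 1) ^ r - ((i - 1) ^ r + 1 ^ r))" by simp
  thus ?case using prime_dvd_power_add[OF assms, of "i - 1" 1] step2(2) by (metis dvd_diff of_nat_id)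
qed

text \<open>The Frobenius congruence, by induction on the coefficient list:
  \<open>prime_dvd_power_add\<close> splits off the constant term, which Fermat's theorem
  handles.\<close>

lemma prime_dvd_power_minus_pcompose:
  fixes f :: "int poly"
  assumes "prime r"
  shows "of_nat r dvd f ^ r - pcompose f (monom 1 r)"
proof (induction f)
  case 0
  show ?case using assms prime_gt_0_nat by (simp add: zero_power)
next
  case (pCons a f)
  have eq: "pCons a f = [:a:] + monom 1 1 * f" by (simp add: monom_altdef)
  have "[:a:] ^ r = [:a ^ r:]" by (induction r) auto
  obtain c where "a ^ r - a = int r * c"
    using prime_dvd_power_minus_self_int[OF assms, of a] by (auto elim: dvdE)
  hence "[:a:] ^ r - [:a:] = of_nat r * [:c:]"
    by (simp add: \<open>[:a:] ^ r = [:a ^ r:]\<close> of_nat_poly)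
  hence "of_nat r dvd [:a:] ^ r - [:a:]" by (rule dvdI)
  moreover have "of_nat r dvd monom 1 r * (f ^ r - pcompose f (monom 1 r))"
    using pCons.IH by simp
  moreover have "of_nat r dvd ([:a:] + monom 1 1 * f) ^ r - ([:a:] ^ r + (monom 1 1 * f) ^ r)"
    by (rule prime_dvd_power_add[OF assms])
  ultimately have "of_nat r dvd ([:a:] + monom 1 1 * f) ^ r - ([:a:] ^ r + (monom 1 1 * f) ^ r)
      + ([:a:] ^ r - [:a:]) + monom 1 r * (f ^ r - pcompose f (monom 1 r))"
    by (intro dvd_add)
  also have "\<dots> = ([:a:] + monom 1 1 * f) ^ r - ([:a:] + monom 1 r * pcompose f (monom 1 r))"
    by (simp add: power_mult_distrib monom_power algebra_simps)
  finally show ?case by (simp add: eq[symmetric] pcompose_pCons del: One_nat_def)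
qed

section \<open>Reduction of exponents modulo \<open>d\<close>\<close>

lemma degree_monom_minus_one [simp]:
  assumes "d \<ge> 1"
  shows "degree (monom 1 d - 1 :: 'a::comm_ring_1 poly) = d"
proof -
  have "degree (monom 1 d + (-1) :: 'a poly) = degree (monom 1 d :: 'a poly)"
    using assms by (intro degree_add_eq_left) (simp add: degree_monom_eq)
  thus ?thesis by (simp add: degree_monom_eq)
qed

lemma monom_minus_one_dvd:
  "(monom 1 d - 1 :: int poly) dvd monom c i - monom c (i mod d)"
proof -
  define m where "m = i div d"
  have "i = d * m + i mod d" by (simp add: m_def)
  hence eq: "monom c i = monom 1 d ^ m * monom c (i mod d)"
    by (simp add: monom_power mult_monom del: mod_mult_div_eq)
  have "(monom 1 d - 1 :: int poly) dvd monom 1 d ^ m - 1"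
    by (metis power_diff_1_eq dvd_triv_left)
  hence "monom 1 d - 1 dvd (monom 1 d ^ m - 1) * monom c (i mod d)" by (rule dvd_mult2)
  thus ?thesis by (simp add: eq algebra_simps)
qed

lemma pcompose_monom_monom:
  "pcompose (monom c i) (monom 1 r) = monom (c::'a::comm_ring_1) (r * i)"
proof (induction i)
  case (Suc i)
  thus ?case by (simp add: monom_Suc pcompose_pCons mult_monom)
qed (simp add: monom_0)

text \<open>Modulo \<open>x ^ d - 1\<close>, the polynomial \<open>P(x ^ r) * Q(x)\<close> has coefficients that are bounded
  independently of \<open>r\<close>, but by the Frobenius congruence they are divisible by \<open>r\<close>.\<close>

lemma dvd_pcompose_large_prime:
  fixes P Q :: "int poly"
  assumes PQ: "P * Q = monom 1 d - 1" and "d \<ge> 1" and "prime r"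
    and large: "(\<Sum>i\<le>degree P. \<Sum>j\<le>degree Q. \<bar>coeff P i * coeff Q j\<bar>) < int r"
  shows "P dvd pcompose P (monom 1 r)"
proof -
  define M :: "int poly" where "M = monom 1 d - 1"
  have deg_M: "degree M = d" using \<open>d \<ge> 1\<close> by (simp add: M_def)
  hence "M \<noteq> 0" using \<open>d \<ge> 1\<close> by auto
  \<comment> \<open>\<open>g\<close> is \<open>pcompose P (monom 1 r) * Q\<close> with exponents
    folded modulo \<open>d\<close>; folding keeps the coefficients within the bound of
    \<open>large\<close>.\<close>
  define g where "g = (\<Sum>i\<le>degree P. \<Sum>j\<le>degree Q. monom (coeff P i * coeff Q j) ((r * i + j) mod d))"
  have "pcompose P (monom 1 r) * Q
      = pcompose (\<Sum>i\<le>degree P. monom (coeff P i) i) (monom 1 r) * (\<Sum>j\<le>degree Q. monom (coeff Q j) j)"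
    by (simp add: poly_as_sum_of_monoms)
  also have "\<dots> = (\<Sum>i\<le>degree P. \<Sum>j\<le>degree Q. monom (coeff P i * coeff Q j) (r * i + j))"
    by (simp add: pcompose_sum pcompose_monom_monom sum_product mult_monom)
  finally have "pcompose P (monom 1 r) * Q - g
      = (\<Sum>i\<le>degree P. \<Sum>j\<le>degree Q. monom (coeff P i * coeff Q j) (r * i + j)
           - monom (coeff P i * coeff Q j) ((r * i + j) mod d))"
    by (simp add: g_def sum_subtractf)
  hence 1: "M dvd pcompose P (monom 1 r) * Q - g"
    by (auto simp: M_def intro!: dvd_sum monom_minus_one_dvd)
  obtain h where h: "P ^ r - pcompose P (monom 1 r) = of_nat r * h"
    using prime_dvd_power_minus_pcompose[OF \<open>prime r\<close>, of P] by (auto elim: dvdE)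
  \<comment> \<open>The same folding applied to the quotient \<open>h\<close> of the Frobenius
    congruence, times \<open>Q\<close>.\<close>
  define k where "k = (\<Sum>i\<le>degree (h * Q). monom (coeff (h * Q) i) (i mod d))"
  have "h * Q - k = (\<Sum>i\<le>degree (h * Q). monom (coeff (h * Q) i) i) - k"
    by (simp add: poly_as_sum_of_monoms)
  also have "\<dots> = (\<Sum>i\<le>degree (h * Q). monom (coeff (h * Q) i) i - monom (coeff (h * Q) i) (i mod d))"
    by (simp add: k_def sum_subtractf)
  finally have 2: "M dvd h * Q - k"
    by (auto simp: M_def intro!: dvd_sum monom_minus_one_dvd)
  have "r > 0" using \<open>prime r\<close> prime_gt_0_nat by auto
  have "P ^ r * Q = P ^ (r - 1) * M"
    using \<open>r > 0\<close> by (cases r) (auto simp: M_def PQ[symmetric] mult_ac)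
  hence 3: "M dvd P ^ r * Q" by simp
  \<comment> \<open>Modulo \<open>M\<close> the right-hand side vanishes. As the left-hand side has
    degree below \<open>d\<close>, it is zero itself, so \<open>r\<close> divides every coefficient
    of \<open>g\<close>.\<close>
  have "g + of_nat r * k = P ^ r * Q - (pcompose P (monom 1 r) * Q - g) - of_nat r * (h * Q - k)"
    using arg_cong[OF h, of "\<lambda>x. x * Q"] by (simp add: algebra_simps)
  hence "M dvd g + of_nat r * k" using 1 2 3 by (metis dvd_diff dvd_mult)
  moreover have "degree (g + of_nat r * k) < d"
  proof -
    have m: "degree (monom (c::int) (i mod d)) < d" for c i
      using \<open>d \<ge> 1\<close> by (metis degree_monom_le le_less_trans mod_less_divisor less_le_trans zero_less_one)
    have "degree g < d" "degree k < d"
      unfolding g_def k_def using \<open>d \<ge> 1\<close> by (auto intro!: degree_sum_less m)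
    moreover have "degree (of_nat r * k) \<le> degree k"
      by (simp add: of_nat_poly)
    ultimately show ?thesis by (intro degree_add_less) auto
  qed
  ultimately have "g + of_nat r * k = 0"
    using dvd_imp_degree_le[of M] deg_M by fastforce
  hence gk: "g = - (of_nat r * k)" by (simp add: eq_neg_iff_add_eq_0)
  have "g = 0"
  proof (rule poly_eqI)
    fix n
    have "coeff g n = - (int r * coeff k n)" by (simp add: gk of_nat_poly)
    hence "int r dvd coeff g n" by simp
    moreover have "\<bar>coeff g n\<bar> < int r"
    proof -
      have "\<bar>coeff g n\<bar> \<le> (\<Sum>i\<le>degree P. \<Sum>j\<le>degree Q.
              \<bar>if (r * i + j) mod d = n then coeff P i * coeff Q j else 0\<bar>)"
        unfolding g_def coeff_sum coeff_monom
        by (rule order_trans[OF sum_abs]) (intro sum_mono sum_abs)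
      also have "\<dots> \<le> (\<Sum>i\<le>degree P. \<Sum>j\<le>degree Q. \<bar>coeff P i * coeff Q j\<bar>)"
        by (intro sum_mono) auto
      finally show ?thesis using large by simp
    qed
    \<comment> \<open>A multiple of \<open>r\<close> of absolute value below \<open>r\<close> is
      zero.\<close>
    ultimately show "coeff g n = coeff 0 n"
      using zdvd_not_zless[of "\<bar>coeff g n\<bar>" "int r"] by (cases "coeff g n = 0") auto
  qed
  hence "M dvd pcompose P (monom 1 r) * Q" using 1 by simp
  hence "P * Q dvd pcompose P (monom 1 r) * Q" by (simp add: PQ M_def)
  moreover have "Q \<noteq> 0" using PQ \<open>M \<noteq> 0\<close> by (auto simp: M_def)
  ultimately show ?thesis by simp
qed

section \<open>Galois conjugates of roots of unity\<close>

abbreviation evp :: "int poly \<Rightarrow> complex \<Rightarrow> complex" where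
  "evp P z \<equiv> poly (map_poly of_int P) z"

text \<open>Induction on the prime factors of \<open>m\<close>: each of them is large, so raising to
  that prime maps roots to roots. The root varies in the induction.\<close>

lemma root_power_large_primes:
  fixes P Q :: "int poly"
  assumes PQ: "P * Q = monom 1 d - 1" and "d \<ge> 1"
    and "m > 0"
    and "\<forall>r. prime r \<longrightarrow> r dvd m \<longrightarrow>
      (\<Sum>i\<le>degree P. \<Sum>j\<le>degree Q. \<bar>coeff P i * coeff Q j\<bar>) < int r"
    and "evp P z = 0"
  shows "evp P (z ^ m) = 0"
  using assms(3-)
proof (induction m arbitrary: z rule: prime_divisors_induct)
  case (unit m)
  thus ?case by simp
next
  case (factor r m)
  have "P dvd pcompose P (monom 1 r)"
    using factor by (intro dvd_pcompose_large_prime[OF PQ \<open>d \<ge> 1\<close>]) auto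
  hence "map_poly of_int P dvd (map_poly of_int (pcompose P (monom 1 r)) :: complex poly)"
    by (metis dvd_def map_poly_of_int_mult)
  hence "evp P (z ^ r) = 0"
    using factor.prems(3) by (metis poly_map_poly_pcompose_monom dvd_trans poly_eq_0_iff_dvd)
  hence "evp P ((z ^ r) ^ m) = 0"
    using factor by (intro factor.IH) auto
  thus ?case by (simp add: power_mult)
qed simp

text \<open>The exponent \<open>m\<close> only matters modulo \<open>N\<close>, so it may be changed to have large prime
  factors only.\<close>

lemma root_power_coprime:
  fixes P :: "int poly"
  assumes "P dvd monom 1 d - 1" and "d \<ge> 1"
    and "z ^ N = 1" and "N \<ge> 1" and "coprime m N" and "evp P z = 0"
  shows "evp P (z ^ m) = 0"
proof -
  obtain Q where PQ: "P * Q = monom 1 d - 1" using assms(1) by (metis dvd_def)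
  define B where "B = nat (\<Sum>i\<le>degree P. \<Sum>j\<le>degree Q. \<bar>coeff P i * coeff Q j\<bar>)"
  \<comment> \<open>With \<open>t\<close> the product of \<open>A\<close>, every prime up to
    \<open>B\<close> divides exactly one of \<open>m\<close> and \<open>N * t\<close>, hence not
    their sum. Primes dividing \<open>m\<close> do not divide \<open>N\<close> by
    coprimality.\<close>
  define A where "A = {r. prime r \<and> r \<le> B \<and> \<not> r dvd m}"
  have "finite A" by (rule finite_subset[of _ "{..B}"]) (auto simp: A_def)
  define t where "t = \<Prod>A"
  have "t > 0" unfolding t_def by (rule prod_pos) (auto simp: A_def prime_gt_0_nat)
  have t: "r dvd t \<longleftrightarrow> r \<in> A" if "prime r" "r \<le> B" for r
  proof -
    have "r dvd t \<longleftrightarrow> (\<exists>a\<in>A. r dvd a)"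
      unfolding t_def using \<open>finite A\<close> \<open>prime r\<close> by (simp add: prime_dvd_prod_iff)
    also have "\<dots> \<longleftrightarrow> r \<in> A" using \<open>prime r\<close> by (auto simp: A_def dest: primes_dvd_imp_eq[of r])
    finally show ?thesis .
  qed
  have big: "B < r" if "prime r" "r dvd m + N * t" for r
  proof (rule ccontr)
    assume "\<not> B < r"
    hence *: "r dvd t \<longleftrightarrow> \<not> r dvd m" using t[of r] that by (auto simp: A_def)
    show False
    proof (cases "r dvd m")
      case True
      hence "r dvd N * t" using that by (simp add: dvd_add_right_iff)
      hence "r dvd N" using * True \<open>prime r\<close> by (auto simp: prime_dvd_mult_iff)
      thus False using True \<open>coprime m N\<close> \<open>prime r\<close> by (metis coprime_common_divisor not_prime_unit)
    next
      case False
      hence "r dvd N * t" using * by simp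
      thus False using that False by (simp add: dvd_add_left_iff)
    qed
  qed
  have "evp P (z ^ (m + N * t)) = 0"
  proof (rule root_power_large_primes[OF PQ \<open>d \<ge> 1\<close>])
    show "m + N * t > 0" using \<open>t > 0\<close> \<open>N \<ge> 1\<close> by simp
    show "\<forall>r. prime r \<longrightarrow> r dvd m + N * t \<longrightarrow>
      (\<Sum>i\<le>degree P. \<Sum>j\<le>degree Q. \<bar>coeff P i * coeff Q j\<bar>) < int r"
      using big by (simp add: B_def nat_less_iff sum_nonneg)
  qed fact
  thus ?thesis using \<open>z ^ N = 1\<close> by (simp add: power_add power_mult)
qed

section \<open>Orders of roots of unity and their conjugates\<close>

lemma power_gcd_eq_1:
  fixes z :: "'a::monoid_mult"
  assumes "z ^ a = 1" "z ^ b = 1"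
  shows "z ^ gcd a b = 1"
proof (cases "a = 0")
  case False
  then obtain x y where "a * x = b * y + gcd a b"
    using bezout_nat[of a b] by auto
  moreover have "z ^ (a * x) = 1" "z ^ (b * y) = 1"
    using assms by (simp_all add: power_mult)
  ultimately show ?thesis by (simp add: power_add)
qed (use assms in simp)

text \<open>For positive \<open>N\<close> these are the elements of exact order \<open>N\<close>.
  Testing only the maximal proper divisors \<open>N div l\<close> keeps the set computable for
  \<open>N\<close> with few prime factors.\<close>

definition primitive_roots :: "nat \<Rightarrow> complex set" where
  "primitive_roots N = {z. z ^ N = 1 \<and> (\<forall>l. prime l \<longrightarrow> l dvd N \<longrightarrow> z ^ (N div l) \<noteq> 1)}"

text \<open>If \<open>N\<close> did not divide \<open>k\<close>, then \<open>z ^ gcd k N = 1\<close>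
  with a proper divisor of \<open>N\<close>, and that divisor divides some
  \<open>N div l\<close>.\<close>

lemma primitive_roots_power_eq_1_iff:
  assumes "z \<in> primitive_roots N" "N \<ge> 1"
  shows "z ^ k = 1 \<longleftrightarrow> N dvd k"
proof
  assume "z ^ k = 1"
  show "N dvd k"
  proof (rule ccontr)
    assume "\<not> N dvd k"
    define g where "g = gcd k N"
    have "z ^ g = 1"
      using \<open>z ^ k = 1\<close> assms(1) unfolding g_def by (auto simp: primitive_roots_def intro: power_gcd_eq_1)
    obtain c where c: "N = g * c" unfolding g_def by (meson dvdE gcd_dvd2)
    have "c \<noteq> 1" using c \<open>\<not> N dvd k\<close> by (metis g_def gcd_dvd1 mult.right_neutral)
    then obtain l where l: "prime l" "l dvd c" using prime_factor_nat by blast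
    then obtain e where "c = l * e" by (auto elim: dvdE)
    hence "N div l = g * e" "l dvd N" using c l prime_gt_0_nat[of l] by auto
    moreover have "z ^ (g * e) = 1" using \<open>z ^ g = 1\<close> by (simp add: power_mult)
    ultimately show False using assms(1) l by (auto simp: primitive_roots_def)
  qed
next
  assume "N dvd k"
  thus "z ^ k = 1" using assms(1) by (auto simp: primitive_roots_def power_mult elim!: dvdE)
qed

text \<open>The first \<open>N\<close> powers of \<open>z\<close> are distinct and so exhaust the
  \<open>N\<close>-th roots of unity. A prime common to the exponent and \<open>N\<close> would
  lower the order of \<open>w\<close>.\<close>

lemma primitive_roots_conjugate:
  assumes z: "z \<in> primitive_roots N" and w: "w \<in> primitive_roots N" and "N \<ge> 1"
  obtains m where "coprime m N" "w = z ^ m"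
proof -
  have "z \<noteq> 0" using z \<open>N \<ge> 1\<close> by (auto simp: primitive_roots_def zero_power)
  have "inj_on (\<lambda>j. z ^ j) {..<N}"
  proof (rule linorder_inj_onI)
    fix i j assume "i < j" "i \<in> {..<N}" "j \<in> {..<N}"
    hence "\<not> N dvd j - i" by (auto dest: dvd_imp_le)
    hence "z ^ (j - i) \<noteq> 1" using primitive_roots_power_eq_1_iff[OF z \<open>N \<ge> 1\<close>] by simp
    moreover have "z ^ j = z ^ i * z ^ (j - i)" using \<open>i < j\<close> by (simp flip: power_add)
    ultimately show "z ^ i \<noteq> z ^ j" using \<open>z \<noteq> 0\<close> by simp
  qed auto
  hence "card ((\<lambda>j. z ^ j) ` {..<N}) = card {z::complex. z ^ N = 1}"
    using \<open>N \<ge> 1\<close> by (simp add: card_image card_roots_unity_eq)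
  moreover have "(\<lambda>j. z ^ j) ` {..<N} \<subseteq> {z. z ^ N = 1}"
    using z by (auto simp: primitive_roots_def power_mult power_commutes simp flip: power_mult)
       (metis power_mult mult.commute power_one)
  ultimately have "(\<lambda>j. z ^ j) ` {..<N} = {z. z ^ N = 1}"
    using \<open>N \<ge> 1\<close> by (intro card_subset_eq finite_roots_unity) auto
  hence "w \<in> (\<lambda>j. z ^ j) ` {..<N}" using w by (auto simp: primitive_roots_def)
  then obtain m where m: "w = z ^ m" by blast
  have "coprime m N"
  proof (rule ccontr)
    assume "\<not> coprime m N"
    then obtain l where l: "prime l" "l dvd m" "l dvd N"
      using \<open>N \<ge> 1\<close> by (metis coprime_iff_gcd_eq_1 prime_factor_nat gcd_dvd1 gcd_dvd2 dvd_trans)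
    then obtain e where e: "m = l * e" by (auto elim: dvdE)
    have "w ^ (N div l) = z ^ ((N div l * l) * e)" by (simp add: m e mult_ac flip: power_mult)
    also have "\<dots> = 1" using z l by (simp add: power_mult primitive_roots_def)
    finally show False using w l by (auto simp: primitive_roots_def)
  qed
  thus thesis using that m by blast
qed

section \<open>Integral divisors of \<open>x ^ d - 1\<close>\<close>

text \<open>On \<open>primitive_roots N\<close> with positive \<open>N\<close> this is the
  \<open>N\<close>-th cyclotomic polynomial. Factorisations become operations on root sets.\<close>

definition root_prod :: "complex set \<Rightarrow> complex poly" where
  "root_prod A = (\<Prod>z\<in>A. [:-z, 1:])"

lemma lead_coeff_monom_minus_one:
  assumes "d \<ge> 1"
  shows "lead_coeff (monom 1 d - 1 :: 'a::comm_ring_1 poly) = 1"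
  using assms by simp

text \<open>The derivative vanishes at most at 0, which is not a root.\<close>

lemma rsquarefree_monom_minus_one:
  assumes "d \<ge> 1"
  shows "rsquarefree (monom 1 d - 1 :: complex poly)"
  unfolding rsquarefree_roots using assms
  by (auto simp: pderiv_diff pderiv_monom poly_monom zero_power)

lemma root_prod_roots_unity:
  assumes "m \<ge> 1"
  shows "root_prod {z. z ^ m = 1} = monom 1 m - 1"
proof -
  have "smult (lead_coeff (monom 1 m - 1)) (\<Prod>z|poly (monom 1 m - 1) z = 0. [:-z, 1:])
          = (monom 1 m - 1 :: complex poly)"
    by (rule complex_poly_decompose_rsquarefree[OF rsquarefree_monom_minus_one[OF assms]])
  thus ?thesis
    unfolding lead_coeff_monom_minus_one[OF assms] by (simp add: root_prod_def poly_monom)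
qed

lemma rsquarefree_dvd:
  fixes p q :: "complex poly"
  assumes "rsquarefree q" "p dvd q"
  shows "rsquarefree p"
  using assms unfolding rsquarefree_roots by (auto elim!: dvdE simp: pderiv_mult)

context
  fixes P :: "int poly" and d :: nat
  assumes P_dvd: "P dvd monom 1 d - 1" and d: "d \<ge> 1"
begin

lemma map_poly_P_dvd: "(map_poly of_int P :: complex poly) dvd monom 1 d - 1"
proof -
  obtain Q where "monom 1 d - 1 = P * Q" using P_dvd by (auto elim: dvdE)
  hence "map_poly of_int (monom 1 d - 1) = (map_poly of_int P * map_poly of_int Q :: complex poly)"
    by (simp add: map_poly_of_int_hom)
  thus ?thesis by (simp add: map_poly_of_int_hom map_poly_monom)
qed

lemma evp_eq_0_imp_root_unity: "evp P z = 0 \<Longrightarrow> z ^ d = 1"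
  using map_poly_P_dvd by (auto elim!: dvdE simp: poly_monom dest!: arg_cong[where f = "\<lambda>f. poly f z"])

lemma finite_evp_roots: "finite {z. evp P z = 0}"
  by (rule finite_subset[OF _ finite_roots_unity[of d]]) (use evp_eq_0_imp_root_unity d in auto)

text \<open>A divisor of a squarefree polynomial has simple roots, so its root set determines it up
  to the leading coefficient.\<close>

lemma map_poly_eq_root_prod:
  "map_poly of_int P = smult (of_int (lead_coeff P)) (root_prod {z. evp P z = 0})"
proof -
  have "lead_coeff (map_poly of_int P :: complex poly) = of_int (lead_coeff P)"
    by (simp add: degree_map_poly coeff_map_poly)
  thus ?thesis
    using complex_poly_decompose_rsquarefree[OF rsquarefree_dvd[OF rsquarefree_monom_minus_one[OF d] map_poly_P_dvd]]
    by (simp add: root_prod_def)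
qed

lemma abs_lead_coeff: "\<bar>lead_coeff P\<bar> = 1"
proof -
  obtain Q where "monom 1 d - 1 = P * Q" using P_dvd by (auto elim: dvdE)
  hence "lead_coeff P * lead_coeff Q = 1"
    using lead_coeff_monom_minus_one[OF d, where ?'a = int] by (simp add: lead_coeff_mult)
  thus ?thesis by (metis zmult_eq_1_iff abs_minus_cancel abs_one)
qed

text \<open>Roots come in full Galois orbits; this serves in place of the irreducibility of
  cyclotomic polynomials.\<close>

lemma primitive_roots_subset:
  assumes "z \<in> primitive_roots N" "N \<ge> 1" "evp P z = 0"
  shows "primitive_roots N \<subseteq> {z. evp P z = 0}"
proof
  fix w assume "w \<in> primitive_roots N"
  then obtain m where "coprime m N" "w = z ^ m"
    using primitive_roots_conjugate[OF assms(1) _ \<open>N \<ge> 1\<close>] by metis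
  thus "w \<in> {z. evp P z = 0}"
    using root_power_coprime[OF P_dvd d _ \<open>N \<ge> 1\<close>] assms by (auto simp: primitive_roots_def)
qed

text \<open>The cyclotomic polynomial of index \<open>l ^ Suc i\<close> then divides
  \<open>P\<close>, and its value at 1 is \<open>l\<close>.\<close>

lemma prime_power_root_imp_dvd:
  assumes "prime l" "z \<in> primitive_roots (l ^ Suc i)" "evp P z = 0"
  shows "int l dvd poly P 1"
proof -
  have "l > 0" using \<open>prime l\<close> prime_gt_0_nat by auto
  hence l: "l ^ j \<ge> 1" for j using Suc_le_eq by auto
  \<comment> \<open>The explicit geometric sum for that cyclotomic polynomial; it is monic and
    integral, so divisibility descends from the complex numbers.\<close>
  define \<Psi> :: "int poly" where "\<Psi> = (\<Sum>j<l. monom 1 (l ^ i) ^ j)"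
  have \<Psi>: "(monom 1 (l ^ i) - 1) * \<Psi> = monom 1 (l ^ Suc i) - 1"
    unfolding \<Psi>_def power_diff_1_eq [symmetric] by (simp add: monom_power mult.commute)
  have only: "l' = l" if "prime l'" "l' dvd l ^ Suc i" for l'
    using that \<open>prime l\<close> by (metis prime_dvd_power primes_dvd_imp_eq)
  have "primitive_roots (l ^ Suc i) = {z. z ^ (l ^ Suc i) = 1} - {z. z ^ (l ^ i) = 1}"
    using only \<open>prime l\<close> \<open>l > 0\<close> by (auto simp: primitive_roots_def)
  moreover have "{z::complex. z ^ (l ^ i) = 1} \<subseteq> {z. z ^ (l ^ Suc i) = 1}"
    by (auto simp: power_mult mult.commute[of l])
  ultimately have "root_prod {z. z ^ (l ^ Suc i) = 1}
      = root_prod (primitive_roots (l ^ Suc i)) * root_prod {z. z ^ (l ^ i) = 1}"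
    unfolding root_prod_def
    using prod.subset_diff[of "{z. z ^ (l ^ i) = 1}" "{z::complex. z ^ (l ^ Suc i) = 1}"]
      finite_roots_unity[OF l[of "Suc i"], where ?'a = complex] by simp
  hence "(monom 1 (l ^ i) - 1) * root_prod (primitive_roots (l ^ Suc i)) = monom 1 (l ^ Suc i) - 1"
    unfolding root_prod_roots_unity[OF l] by (simp only: mult.commute)
  also have "\<dots> = (monom 1 (l ^ i) - 1) * map_poly of_int \<Psi>"
    using arg_cong[OF \<Psi>, of "map_poly of_int :: _ \<Rightarrow> complex poly"]
    by (simp add: map_poly_of_int_hom map_poly_monom del: power_Suc)
  finally have "map_poly of_int \<Psi> = root_prod (primitive_roots (l ^ Suc i))"
    using degree_monom_minus_one[OF l, where ?'a = complex] l[of i] by (metis degree_0 mult_left_cancel not_one_le_zero)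
  also have "\<dots> dvd root_prod {z. evp P z = 0}"
    unfolding root_prod_def
    using primitive_roots_subset[OF assms(2) l assms(3)] finite_evp_roots
    by (intro prod_dvd_prod_subset)
  also have "\<dots> dvd map_poly of_int P"
    by (subst map_poly_eq_root_prod) (simp add: dvd_smult)
  finally have dvd: "(map_poly of_int \<Psi> :: complex poly) dvd map_poly of_int P" .
  have "lead_coeff \<Psi> = 1"
    using arg_cong[OF \<Psi>, of lead_coeff] lead_coeff_monom_minus_one[OF l, where ?'a = int]
    by (simp only: lead_coeff_mult mult_1)
  hence "\<Psi> dvd P" using dvd by (intro dvd_of_map_poly_dvd) auto
  moreover have "poly \<Psi> 1 = int l" by (simp add: \<Psi>_def poly_sum poly_monom)
  ultimately show ?thesis by (auto elim!: dvdE)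
qed

end

section \<open>Hilbert series\<close>

text \<open>The coefficient ring is left open: integers match \<open>semigroup_poly\<close>, complex
  numbers match \<open>root_prod\<close>.\<close>

definition hilbert_fps :: "nat set \<Rightarrow> 'a::comm_ring_1 fps" where
  "hilbert_fps A = Abs_fps (\<lambda>n. if n \<in> A then 1 else 0)"

lemma hilbert_fps_nth [simp]: "hilbert_fps A $ n = (if n \<in> A then 1 else 0)"
  by (simp add: hilbert_fps_def)

lemma gen2_iff: "n \<in> gen2 a b \<longleftrightarrow> (\<exists>i j. n = i * a + j * b)"
  by (auto simp: gen2_def)

text \<open>This is the Apery set with respect to \<open>a\<close>. In \<open>i * a + j * b\<close>,
  a positive \<open>i\<close> allows subtracting \<open>a\<close>, and for \<open>j\<close> at least
  \<open>a\<close> one can trade \<open>a\<close> copies of \<open>b\<close> for \<open>b\<close>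
  copies of \<open>a\<close>. Conversely, coprimality makes \<open>a\<close> divide a difference
  smaller than \<open>a\<close>.\<close>

lemma gen2_apery:
  assumes "coprime a b" "a \<ge> 1" "b \<ge> 1"
  shows "n \<in> gen2 a b \<and> \<not> (a \<le> n \<and> n - a \<in> gen2 a b) \<longleftrightarrow> (\<exists>j<a. n = j * b)"
proof
  assume *: "n \<in> gen2 a b \<and> \<not> (a \<le> n \<and> n - a \<in> gen2 a b)"
  hence notin: "\<not> (a \<le> n \<and> n - a \<in> gen2 a b)" by blast
  from * obtain i j where ij: "n = i * a + j * b" by (auto simp: gen2_iff)
  have "i = 0"
  proof (rule ccontr)
    assume "i \<noteq> 0"
    then obtain i' where "i = Suc i'" by (cases i) auto
    hence "a \<le> n" "n - a = i' * a + j * b" using ij by auto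
    thus False using notin by (auto simp: gen2_iff)
  qed
  have "j < a"
  proof (rule ccontr)
    assume "\<not> j < a"
    then obtain j' where "j = a + j'" using le_Suc_ex not_less by blast
    moreover obtain b' where "b = Suc b'" using \<open>b \<ge> 1\<close> by (cases b) auto
    ultimately have "n = a + (b' * a + j' * b)" using ij \<open>i = 0\<close> by (simp add: algebra_simps)
    thus False using notin by (auto simp: gen2_iff)
  qed
  thus "\<exists>j<a. n = j * b" using ij \<open>i = 0\<close> by auto
next
  assume "\<exists>j<a. n = j * b"
  then obtain j where "j < a" and n: "n = j * b" by blast
  have "n \<in> gen2 a b" unfolding gen2_iff n by (rule exI[of _ 0]) auto
  moreover have False if "a \<le> n" and mem: "n - a \<in> gen2 a b"
  proof -
    obtain x y where "n - a = x * a + y * b" using mem unfolding gen2_iff by blast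
    hence xy: "j * b = Suc x * a + y * b" using \<open>a \<le> n\<close> n by simp
    hence "y * b \<le> j * b" by simp
    hence "y \<le> j" using \<open>b \<ge> 1\<close> by simp
    have "(j - y) * b = Suc x * a" using xy by (simp add: diff_mult_distrib)
    hence "a dvd (j - y) * b" by simp
    hence "a dvd j - y" using \<open>coprime a b\<close> by (simp add: coprime_dvd_mult_left_iff)
    hence "j - y = 0" using \<open>j < a\<close> by (metis dvd_imp_le less_imp_diff_less not_less gr0I)
    thus False using \<open>(j - y) * b = Suc x * a\<close> \<open>a \<ge> 1\<close> by simp
  qed
  ultimately show "n \<in> gen2 a b \<and> \<not> (a \<le> n \<and> n - a \<in> gen2 a b)" by blast
qed

text \<open>Multiplying by \<open>1 - fps_X ^ a\<close> leaves the Apery set, a finite geometric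
  progression in \<open>fps_X ^ b\<close>, which the last factor sums.\<close>

lemma hilbert_fps_gen2:
  assumes "coprime a b" "a \<ge> 1" "b \<ge> 1"
  shows "hilbert_fps (gen2 a b) * (1 - fps_X ^ a) * (1 - fps_X ^ b) = (1 - fps_X ^ (a * b) :: 'a::comm_ring_1 fps)"
proof -
  \<comment> \<open>Closure under adding \<open>a\<close> ensures that no coefficient -1
    arises.\<close>
  have closed: "n + a \<in> gen2 a b" if "n \<in> gen2 a b" for n
    using that by (auto simp: gen2_iff) (metis add.assoc add.commute mult_Suc)
  have "hilbert_fps (gen2 a b) * (1 - fps_X ^ a) = (\<Sum>j<a. (fps_X ^ b) ^ j :: 'a fps)"
  proof (rule fps_ext)
    fix n
    have "(hilbert_fps (gen2 a b) * (1 - fps_X ^ a)) $ n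
        = (hilbert_fps (gen2 a b) - fps_X ^ a * hilbert_fps (gen2 a b) :: 'a fps) $ n"
      by (simp add: algebra_simps)
    also have "\<dots> = (if n \<in> gen2 a b \<and> \<not> (a \<le> n \<and> n - a \<in> gen2 a b) then 1 else 0)"
    proof (cases "n < a")
      case False
      thus ?thesis using closed[of "n - a"] by (auto simp: fps_X_power_mult_nth)
    qed (auto simp: fps_X_power_mult_nth)
    also have "\<dots> = (if \<exists>j<a. n = j * b then 1 else 0)"
      by (subst gen2_apery[OF assms]) simp
    also have "\<dots> = (\<Sum>j<a. if n = j * b then 1 else 0 :: 'a)"
    proof (cases "\<exists>j<a. n = j * b")
      case True
      then obtain k where k: "k < a" "n = k * b" by auto
      hence "(n = j * b) = (k = j)" for j using \<open>b \<ge> 1\<close> by simp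
      thus ?thesis using k(1) by (auto simp: k(2)[symmetric] simp del: k(2))
    next
      case False
      hence "(\<Sum>j<a. if n = j * b then 1 else 0 :: 'a) = (\<Sum>j<a. 0)" by (intro sum.cong) auto
      thus ?thesis using False by auto
    qed
    also have "\<dots> = (\<Sum>j<a. (fps_X ^ b) ^ j :: 'a fps) $ n"
      by (simp add: fps_sum_nth fps_X_power_nth mult.commute[of b] flip: power_mult)
    finally show "(hilbert_fps (gen2 a b) * (1 - fps_X ^ a)) $ n = (\<Sum>j<a. (fps_X ^ b) ^ j :: 'a fps) $ n" .
  qed
  moreover have "(\<Sum>j<a. (fps_X ^ b) ^ j) * (1 - fps_X ^ b) = (1 - fps_X ^ (a * b) :: 'a fps)"
    using power_diff_1_eq[of "fps_X ^ b :: 'a fps" a]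
    by (simp add: algebra_simps flip: power_mult)
  ultimately show ?thesis by simp
qed

section \<open>Congruence of power series modulo \<open>fps_X ^ (N + 1)\<close>\<close>

definition fps_eq_upto :: "nat \<Rightarrow> 'a::comm_ring_1 fps \<Rightarrow> 'a fps \<Rightarrow> bool" where
  "fps_eq_upto N f g \<longleftrightarrow> (\<forall>n\<le>N. f $ n = g $ n)"

lemma fps_eq_upto_mult:
  assumes "fps_eq_upto N f g" "fps_eq_upto N f' g'"
  shows "fps_eq_upto N (f * f') (g * g')"
  using assms by (auto simp: fps_eq_upto_def fps_mult_nth intro!: sum.cong)

lemma fps_eq_upto_prod_1:
  assumes "\<And>x. x \<in> A \<Longrightarrow> fps_eq_upto N (f x) 1"
  shows "fps_eq_upto N (prod f A) 1"
  using assms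
proof (induction A rule: infinite_finite_induct)
  case (insert x A)
  thus ?case using fps_eq_upto_mult[of N "f x" 1 "prod f A" 1] by simp
qed (auto simp: fps_eq_upto_def)

lemma fps_eq_upto_one_minus_X_power: "N < m \<Longrightarrow> fps_eq_upto N (1 - fps_X ^ m) 1"
  by (auto simp: fps_eq_upto_def fps_X_power_nth)

text \<open>The series of all naturals is the inverse of \<open>1 - fps_X\<close>, so passing to the
  gaps gives an explicit polynomial as witness for \<open>semigroup_poly\<close>.\<close>

definition semigroup_poly_gaps :: "nat set \<Rightarrow> 'a::comm_ring_1 poly" where
  "semigroup_poly_gaps A = 1 - (1 - monom 1 1) * (\<Sum>g\<in>UNIV - A. monom 1 g)"

lemma fps_of_poly_semigroup_poly_gaps:
  assumes "finite (UNIV - A)"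
  shows "fps_of_poly (semigroup_poly_gaps A :: 'a::comm_ring_1 poly) = (1 - fps_X) * hilbert_fps A"
proof -
  have "(\<Sum>g\<in>UNIV - A. fps_X ^ g) + hilbert_fps A = (Abs_fps (\<lambda>_. 1) :: 'a fps)"
    by (rule fps_ext) (auto simp: fps_sum_nth fps_X_power_nth assms)
  moreover have "(1 - fps_X) * Abs_fps (\<lambda>_. 1) = (1 :: 'a fps)"
    by (rule fps_ext) (auto simp: algebra_simps)
  ultimately have "(1 - fps_X) * ((\<Sum>g\<in>UNIV - A. fps_X ^ g) + hilbert_fps A) = (1 :: 'a fps)"
    by simp
  thus ?thesis
    by (simp add: semigroup_poly_gaps_def fps_of_poly_diff fps_of_poly_add fps_of_poly_mult fps_of_poly_sum
          fps_of_poly_monom algebra_simps del: One_nat_def)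
qed

lemma semigroup_poly_eq_gaps:
  assumes "finite (UNIV - T)"
  shows "semigroup_poly T = semigroup_poly_gaps T"
  unfolding semigroup_poly_def
proof (rule the_equality)
  show X: "fps_of_poly (semigroup_poly_gaps T) =
     (1 - fps_X) * Abs_fps (\<lambda>n. if n \<in> T then 1 else 0 :: int)"
    using fps_of_poly_semigroup_poly_gaps[OF assms, where ?'a = int] by (simp add: hilbert_fps_def)
  fix p :: "int poly"
  assume "fps_of_poly p = (1 - fps_X) * Abs_fps (\<lambda>n. if n \<in> T then 1 else 0)"
  hence "fps_of_poly p = fps_of_poly (semigroup_poly_gaps T)" by (rule trans[OF _ X[symmetric]])
  thus "p = semigroup_poly_gaps T" by (simp only: fps_of_poly_eq_iff)
qed

lemma map_poly_semigroup_poly_gaps: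
  "map_poly of_int (semigroup_poly_gaps T) = (semigroup_poly_gaps T :: 'a::comm_ring_1 poly)"
  by (simp add: semigroup_poly_gaps_def map_poly_of_int_hom map_poly_monom)

lemma poly_semigroup_poly_gaps_1: "poly (semigroup_poly_gaps T) 1 = 1"
  by (simp add: semigroup_poly_gaps_def poly_monom)

section \<open>Depth \<open>p ^ n * q\<close> and height 1\<close>

context
  fixes p q :: nat
  assumes p: "prime p" and q: "prime q" and pq: "p \<noteq> q"
begin

lemma pow_pos: "p ^ j \<ge> 1" "q \<ge> 1" "p ^ j * q \<ge> 1"
  using prime_gt_0_nat[OF p] prime_gt_0_nat[OF q] by (auto simp: Suc_le_eq)

lemma coprime_pow: "coprime (p ^ j) q"
  using p q pq by (simp add: primes_coprime)

text \<open>Only \<open>p\<close> and \<open>q\<close> divide the index, so just two maximal proper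
  divisors have to be excluded.\<close>

lemma primitive_roots_pq:
  "primitive_roots (p ^ Suc j * q)
     = {z. z ^ (p ^ Suc j * q) = 1} - ({z. z ^ (p ^ j * q) = 1} \<union> {z. z ^ (p ^ Suc j) = 1})"
proof -
  have dvd: "l dvd p ^ Suc j * q \<longleftrightarrow> l = p \<or> l = q" if "prime l" for l
    using that p q by (metis dvd_mult dvd_mult2 dvd_power dvd_refl prime_dvd_mult_iff
      prime_dvd_power primes_dvd_imp_eq zero_less_Suc)
  have "p ^ Suc j * q div p = p ^ j * q" "p ^ Suc j * q div q = p ^ Suc j"
    using prime_gt_0_nat[OF p] prime_gt_0_nat[OF q] by auto
  thus ?thesis using dvd p q by (auto simp: primitive_roots_def simp del: power_Suc)
qed

lemma roots_unity_mono:
  "a dvd b \<Longrightarrow> {z::complex. z ^ a = 1} \<subseteq> {z. z ^ b = 1}"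
  by (auto elim!: dvdE simp: power_mult)

text \<open>x\<close>

lemma root_prod_primitive_roots_pq:
  "root_prod (primitive_roots (p ^ Suc j * q)) * ((monom 1 (p ^ j * q) - 1) * (monom 1 (p ^ Suc j) - 1))
     = (monom 1 (p ^ Suc j * q) - 1) * (monom 1 (p ^ j) - 1)"
proof -
  define A B C where "A = {z::complex. z ^ (p ^ j * q) = 1}" and "B = {z::complex. z ^ (p ^ Suc j) = 1}"
    and "C = {z::complex. z ^ (p ^ Suc j * q) = 1}"
  have fin: "finite A" "finite B" "finite C"
    unfolding A_def B_def C_def using pow_pos(1,3)[of j] pow_pos(1,3)[of "Suc j"] by (auto intro!: finite_roots_unity simp del: power_Suc)
  have sub: "A \<union> B \<subseteq> C"
    unfolding A_def B_def C_def using roots_unity_mono[of "p ^ j * q" "p ^ Suc j * q"]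
      roots_unity_mono[of "p ^ Suc j" "p ^ Suc j * q"] by auto
  have "gcd (p ^ j * q) (p ^ Suc j) = p ^ j"
  proof -
    have "gcd q p = 1" using p q pq by (simp add: primes_coprime)
    have "gcd (p ^ j * q) (p ^ j * p) = p ^ j * gcd q p" by (rule gcd_mult_distrib_nat [symmetric])
    thus ?thesis using \<open>gcd q p = 1\<close> by (simp add: mult.commute)
  qed
  hence inter: "A \<inter> B = {z. z ^ (p ^ j) = 1}"
    unfolding A_def B_def
    using power_gcd_eq_1[of _ "p ^ j * q" "p ^ Suc j"] by (auto simp: power_mult mult.commute[of p])
  have "root_prod (A \<union> B) * root_prod (A \<inter> B) = root_prod A * root_prod B"
    unfolding root_prod_def using fin by (intro prod.union_inter)
  moreover have "root_prod C = root_prod (C - (A \<union> B)) * root_prod (A \<union> B)"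
    unfolding root_prod_def using fin sub by (intro prod.subset_diff)
  ultimately have "root_prod (C - (A \<union> B)) * (root_prod A * root_prod B) = root_prod C * root_prod (A \<inter> B)"
    by (simp add: mult.assoc)
  thus ?thesis
    unfolding inter primitive_roots_pq
    unfolding A_def B_def C_def by (simp only: root_prod_roots_unity pow_pos)
qed

definition cyclo_fps :: "nat \<Rightarrow> complex fps" where
  "cyclo_fps j = fps_of_poly (root_prod (primitive_roots (p ^ Suc j * q)))"

lemma cyclo_fps_eq:
  "cyclo_fps j * ((1 - fps_X ^ (p ^ j * q)) * (1 - fps_X ^ (p ^ Suc j)))
     = (1 - fps_X ^ (p ^ Suc j * q)) * (1 - fps_X ^ (p ^ j))"
proof -
  have "cyclo_fps j * ((fps_X ^ (p ^ j * q) - 1) * (fps_X ^ (p ^ Suc j) - 1))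
     = (fps_X ^ (p ^ Suc j * q) - 1) * (fps_X ^ (p ^ j) - 1)"
    using arg_cong[OF root_prod_primitive_roots_pq[of j], of fps_of_poly]
    unfolding cyclo_fps_def by (simp only: fps_of_poly_mult fps_of_poly_diff fps_of_poly_monom'
        fps_of_poly_1)
  moreover have "(a - 1) * (b - 1) = (1 - a) * (1 - b)" for a b :: "complex fps"
    by (simp add: algebra_simps)
  ultimately show ?thesis by simp
qed

lemma one_minus_X_power_nonzero: "m \<ge> 1 \<Longrightarrow> 1 - fps_X ^ m \<noteq> (0 :: complex fps)"
  by (auto simp: fps_eq_iff fps_X_power_nth intro!: exI[of _ 0])

lemma prod_cyclo_fps:
  "(\<Prod>j<k. cyclo_fps j) = (1 - fps_X) * hilbert_fps (gen2 (p ^ k) q)"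
proof -
  have "(\<Prod>j<k. cyclo_fps j) * ((1 - fps_X ^ (p ^ k)) * (1 - fps_X ^ q))
           = (1 - fps_X ^ (p ^ k * q)) * (1 - fps_X)"
  proof (induction k)
    case (Suc k)
    define a where "a = (\<Prod>j<k. cyclo_fps j)"
    define b where "b = cyclo_fps k"
    define x where "x = (1 - fps_X ^ (p ^ k) :: complex fps)"
    define x' where "x' = (1 - fps_X ^ (p ^ Suc k) :: complex fps)"
    define y where "y = (1 - fps_X ^ (p ^ k * q) :: complex fps)"
    define y' where "y' = (1 - fps_X ^ (p ^ Suc k * q) :: complex fps)"
    define u where "u = (1 - fps_X ^ q :: complex fps)"
    define v where "v = (1 - fps_X :: complex fps)"
    have IH: "a * (x * u) = y * v" using Suc.IH by (simp only: a_def x_def u_def y_def v_def)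
    have eq: "b * (y * x') = y' * x" using cyclo_fps_eq[of k]
      by (simp only: b_def x_def x'_def y_def y'_def)
    have "y * ((a * b) * (x' * u)) = (a * u) * (b * (y * x'))" by (simp add: mult_ac)
    also have "\<dots> = y' * (a * (x * u))" unfolding eq by (simp add: mult_ac)
    also have "\<dots> = y * (y' * v)" unfolding IH by (simp add: mult_ac)
    finally have "(a * b) * (x' * u) = y' * v"
      using one_minus_X_power_nonzero[OF pow_pos(3)[of k]] by (simp add: y_def)
    thus ?case by (simp only: a_def b_def x'_def u_def y'_def v_def prod.lessThan_Suc)
  qed simp
  also have "\<dots> = ((1 - fps_X) * hilbert_fps (gen2 (p ^ k) q)) * ((1 - fps_X ^ (p ^ k)) * (1 - fps_X ^ q))"
    using hilbert_fps_gen2[OF coprime_pow pow_pos(1) pow_pos(2), of k, where ?'a = complex]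
    by (simp add: mult_ac)
  finally show ?thesis
    using one_minus_X_power_nonzero[OF pow_pos(1)[of k]] one_minus_X_power_nonzero[OF pow_pos(2)]
    by simp
qed

lemma cyclo_fps_eq_upto:
  assumes "N < p ^ Suc j" "N < p ^ j * q"
  shows "fps_eq_upto N (cyclo_fps j) (1 - fps_X ^ (p ^ j))"
proof -
  have refl: "fps_eq_upto N f f" for f :: "complex fps" by (simp add: fps_eq_upto_def)
  have "N < p ^ Suc j * q" using assms pow_pos(2) by (metis less_le_trans mult.right_neutral mult_le_mono2)
  have "fps_eq_upto N (cyclo_fps j * ((1 - fps_X ^ (p ^ j * q)) * (1 - fps_X ^ (p ^ Suc j))))
      (cyclo_fps j * (1 * 1))"
    by (intro fps_eq_upto_mult refl fps_eq_upto_one_minus_X_power assms)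
  moreover have "fps_eq_upto N ((1 - fps_X ^ (p ^ Suc j * q)) * (1 - fps_X ^ (p ^ j)))
      (1 * (1 - fps_X ^ (p ^ j) :: complex fps))"
    by (intro fps_eq_upto_mult refl fps_eq_upto_one_minus_X_power) fact
  ultimately show ?thesis unfolding cyclo_fps_eq by (simp add: fps_eq_upto_def)
qed

lemma disjoint_primitive_roots_pq:
  assumes "i < j"
  shows "primitive_roots (p ^ Suc i * q) \<inter> primitive_roots (p ^ Suc j * q) = {}"
proof -
  have "p ^ Suc i * q dvd p ^ j * q" using assms by (intro mult_dvd_mono le_imp_power_dvd) auto
  thus ?thesis using roots_unity_mono unfolding primitive_roots_pq by blast
qed

lemma semigroup_generated:
  assumes T: "numerical_semigroup T" and depth: "cyclotomic_depth_height T (p ^ n * q) 1" and "n > 0"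
  shows "T = gen2 (p ^ n) q"
proof -
  define P where "P = semigroup_poly T"
  have T0: "0 \<in> T" and T_add: "\<And>a b. a \<in> T \<Longrightarrow> b \<in> T \<Longrightarrow> a + b \<in> T" and "finite (UNIV - T)"
    using T by (auto simp: numerical_semigroup_def)
  have P: "P = semigroup_poly_gaps T"
    unfolding P_def by (rule semigroup_poly_eq_gaps) fact
  have P_dvd: "P dvd monom 1 (p ^ n * q) - 1"
    and minimal: "\<And>d'. d' dvd p ^ n * q \<Longrightarrow> d' < p ^ n * q \<Longrightarrow> \<not> P dvd monom 1 d' - 1"
    using depth by (auto simp: cyclotomic_depth_height_def P_def)
  note P_facts = P_dvd pow_pos(3)
  have "poly P 1 = 1" by (simp add: P poly_semigroup_poly_gaps_1)
  define Z where "Z = {z. evp P z = 0}"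
  have "finite Z" unfolding Z_def by (rule finite_evp_roots[OF P_facts])
  have not_prime_power: "z \<notin> primitive_roots (l ^ Suc i)" if "z \<in> Z" "prime l" for z l i
  proof
    assume "z \<in> primitive_roots (l ^ Suc i)"
    hence "int l dvd poly P 1"
      using prime_power_root_imp_dvd[OF P_facts \<open>prime l\<close>] \<open>z \<in> Z\<close> by (auto simp: Z_def)
    thus False using \<open>poly P 1 = 1\<close> \<open>prime l\<close> by (metis int_dvd_int_iff of_nat_1 nat_dvd_1_iff_1 not_prime_1)
  qed
  have "1 \<notin> Z"
    using map_poly_semigroup_poly_gaps[of T, where ?'a = complex]
      poly_semigroup_poly_gaps_1[of T, where ?'a = complex] by (simp add: Z_def P)
  define R where "R j = primitive_roots (p ^ Suc j * q)" for j
  have Z_cases: "\<exists>j<n. z \<in> R j" if "z \<in> Z" for z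
  proof -
    have "z ^ (p ^ n * q) = 1"
      using evp_eq_0_imp_root_unity[OF P_facts] \<open>z \<in> Z\<close> by (auto simp: Z_def)
    define i where "i = (LEAST i. z ^ (p ^ i * q) = 1)"
    have i: "z ^ (p ^ i * q) = 1" "i \<le> n"
      unfolding i_def using \<open>z ^ (p ^ n * q) = 1\<close> by (auto intro: LeastI Least_le)
    show ?thesis
    proof (cases i)
      case 0
      have only: "l = q" if "prime l" "l dvd q" for l
        using that q by (metis primes_dvd_imp_eq)
      have "z \<in> primitive_roots (q ^ Suc 0)"
        using 0 i(1) \<open>1 \<notin> Z\<close> \<open>z \<in> Z\<close> prime_gt_0_nat[OF q]
        by (auto simp: primitive_roots_def dest: only)
      thus ?thesis using not_prime_power[OF \<open>z \<in> Z\<close> q] by blast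
    next
      case (Suc j)
      have j: "z ^ (p ^ j * q) \<noteq> 1"
        using not_less_Least[of j "\<lambda>i. z ^ (p ^ i * q) = 1"] Suc by (auto simp: i_def)
      have "z ^ (p ^ Suc j) \<noteq> 1"
      proof
        assume "z ^ (p ^ Suc j) = 1"
        moreover have "z ^ (p ^ j) \<noteq> 1" using j by (auto simp: power_mult)
        moreover have "l = p" if "prime l" "l dvd p ^ Suc j" for l
          using that p by (metis prime_dvd_power primes_dvd_imp_eq)
        ultimately have "z \<in> primitive_roots (p ^ Suc j)"
          using prime_gt_0_nat[OF p] by (auto simp: primitive_roots_def)
        thus False using not_prime_power[OF \<open>z \<in> Z\<close> p] by blast
      qed
      hence "z \<in> R j" unfolding R_def primitive_roots_pq using i j Suc by auto
      moreover have "j < n" using i(2) Suc by simp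
      ultimately show ?thesis by blast
    qed
  qed
  have R_subset: "R j \<subseteq> Z" if "z \<in> R j" "z \<in> Z" for z j
    using primitive_roots_subset[OF P_facts, of z "p ^ Suc j * q"] that pow_pos(3)[of "Suc j"]
    by (simp add: R_def Z_def)
  define S where "S = {j. j < n \<and> R j \<subseteq> Z}"
  have "finite S" "S \<subseteq> {..<n}" by (auto simp: S_def)
  have Z_eq: "Z = (\<Union>j\<in>S. R j)" using Z_cases R_subset by (fastforce simp: S_def)
  have "root_prod Z = (\<Prod>j\<in>S. root_prod (R j))"
    unfolding root_prod_def Z_eq
  proof (rule prod.UNION_disjoint)
    show "\<forall>i\<in>S. finite (R i)" using \<open>finite Z\<close> finite_subset by (auto simp: S_def)
    show "\<forall>i\<in>S. \<forall>j\<in>S. i \<noteq> j \<longrightarrow> R i \<inter> R j = {}"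
      using disjoint_primitive_roots_pq unfolding R_def by (metis inf_commute linorder_neqE_nat)
  qed fact
  define c :: complex where "c = of_int (lead_coeff P)"
  have map_poly_P: "map_poly of_int P = smult c (root_prod Z)"
    unfolding c_def Z_def by (rule map_poly_eq_root_prod[OF P_facts])
  have "(1 - fps_X) * hilbert_fps T = fps_of_poly (map_poly of_int P :: complex poly)"
    unfolding P map_poly_semigroup_poly_gaps
    by (rule fps_of_poly_semigroup_poly_gaps [symmetric]) fact
  also have "\<dots> = fps_const c * fps_of_poly (root_prod Z)"
    by (subst map_poly_P) (simp add: fps_of_poly_smult)
  also have "fps_of_poly (root_prod Z) = (\<Prod>j\<in>S. cyclo_fps j)"
    unfolding \<open>root_prod Z = _\<close> by (simp add: fps_of_poly_prod cyclo_fps_def R_def)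
  finally have series: "(1 - fps_X) * hilbert_fps T = fps_const c * (\<Prod>j\<in>S. cyclo_fps j)" .

  obtain n' where n': "n = Suc n'" using \<open>n > 0\<close> by (cases n) auto
  have "n' \<in> S"
  proof (rule ccontr)
    assume "n' \<notin> S"
    have "Z \<subseteq> {z. z ^ (p ^ n' * q) = 1}"
    proof
      fix z assume "z \<in> Z"
      then obtain j where "j \<in> S" "z \<in> R j" using Z_eq by auto
      hence "j < n'" using \<open>n' \<notin> S\<close> n' by (auto simp: S_def less_Suc_eq)
      hence "p ^ Suc j * q dvd p ^ n' * q" by (intro mult_dvd_mono le_imp_power_dvd) auto
      thus "z \<in> {z. z ^ (p ^ n' * q) = 1}"
        using \<open>z \<in> R j\<close> roots_unity_mono unfolding R_def primitive_roots_pq by blast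
    qed
    hence "root_prod Z dvd root_prod {z. z ^ (p ^ n' * q) = 1}"
      unfolding root_prod_def by (intro prod_dvd_prod_subset finite_roots_unity pow_pos)
    hence "root_prod Z dvd monom 1 (p ^ n' * q) - 1"
      by (simp only: root_prod_roots_unity pow_pos)
    moreover have "c \<noteq> 0" using abs_lead_coeff[OF P_facts] by (auto simp: c_def)
    ultimately have "smult c (root_prod Z) dvd monom 1 (p ^ n' * q) - 1"
      by (simp add: smult_dvd)
    hence "map_poly of_int P dvd (map_poly of_int (monom 1 (p ^ n' * q) - 1) :: complex poly)"
      by (subst map_poly_P) (simp add: map_poly_of_int_hom map_poly_monom)
    hence "P dvd monom 1 (p ^ n' * q) - 1"
      by (rule dvd_of_map_poly_dvd[OF abs_lead_coeff[OF P_facts]])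
    moreover have "p ^ n' * q < p ^ n * q" using n' prime_gt_1_nat[OF p] pow_pos by simp
    moreover have "p ^ n' * q dvd p ^ n * q" using n' by (intro mult_dvd_mono) auto
    ultimately show False using minimal by blast
  qed

  have "1 - fps_X \<noteq> (0 :: complex fps)" using one_minus_X_power_nonzero[of 1] by simp
  show ?thesis
  proof (cases "{..<n} \<subseteq> S")
    case True
    hence "S = {..<n}" using \<open>S \<subseteq> {..<n}\<close> by auto
    hence "(1 - fps_X) * hilbert_fps T = (1 - fps_X) * (fps_const c * hilbert_fps (gen2 (p ^ n) q))"
      unfolding series by (simp add: prod_cyclo_fps mult_ac)
    hence eq: "hilbert_fps T = fps_const c * hilbert_fps (gen2 (p ^ n) q)"
      using \<open>1 - fps_X \<noteq> (0 :: complex fps)\<close> by simp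
    have coeffs: "(if m \<in> T then 1 else 0) = c * (if m \<in> gen2 (p ^ n) q then 1 else 0)" for m
      using arg_cong[OF eq, of "\<lambda>f. f $ m"] by simp
    have "0 \<in> gen2 (p ^ n) q" by (simp add: gen2_iff)
    hence "c = 1" using coeffs[of 0] T0 by simp
    hence "m \<in> T \<longleftrightarrow> m \<in> gen2 (p ^ n) q" for m using coeffs[of m] by (auto split: if_splits)
    thus ?thesis by (rule set_eqI)
  next
    case False
    define k where "k = (LEAST k. k \<notin> S)"
    have "\<exists>k. k \<notin> S" using False by auto
    hence "k \<notin> S" unfolding k_def by (rule LeastI_ex)
    have below_k: "{..<k} \<subseteq> S" unfolding k_def using not_less_Least by blast
    have "k < n" using False \<open>S \<subseteq> {..<n}\<close> unfolding k_def
      by (metis lessThan_iff Least_le le_less_trans subsetI)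
    hence "k < n'" using \<open>k \<notin> S\<close> \<open>n' \<in> S\<close> n' by (metis less_antisym)
    define l where "l = (LEAST l. l \<in> S \<and> k < l)"
    have "\<exists>l. l \<in> S \<and> k < l" using \<open>n' \<in> S\<close> \<open>k < n'\<close> by auto
    hence l: "l \<in> S \<and> k < l" unfolding l_def by (rule LeastI_ex)
    have l_le: "l \<le> j" if "j \<in> S" "k < j" for j unfolding l_def using that by (simp add: Least_le)
    define S' where "S' = {j\<in>S. l < j}"
    have "S = {..<k} \<union> insert l S'"
    proof (intro equalityI subsetI)
      fix j assume "j \<in> S"
      thus "j \<in> {..<k} \<union> insert l S'"
        using \<open>k \<notin> S\<close> l_le[of j] unfolding S'_def by (cases j k rule: linorder_cases) auto
    qed (use below_k l in \<open>auto simp: S'_def\<close>)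
    moreover have "{..<k} \<inter> insert l S' = {}" "l \<notin> S'" "finite S'"
      using l \<open>finite S\<close> by (auto simp: S'_def)
    ultimately have "(\<Prod>j\<in>S. cyclo_fps j)
        = (\<Prod>j<k. cyclo_fps j) * (cyclo_fps l * (\<Prod>j\<in>S'. cyclo_fps j))"
      by (simp add: prod.union_disjoint)
    hence "(1 - fps_X) * hilbert_fps T = (1 - fps_X) * (fps_const c * (hilbert_fps (gen2 (p ^ k) q)
        * (cyclo_fps l * (\<Prod>j\<in>S'. cyclo_fps j))))"
      unfolding series by (simp add: prod_cyclo_fps mult_ac)
    hence T_eq: "hilbert_fps T = fps_const c * (hilbert_fps (gen2 (p ^ k) q)
        * (cyclo_fps l * (\<Prod>j\<in>S'. cyclo_fps j)))"
      using \<open>1 - fps_X \<noteq> (0 :: complex fps)\<close> by simp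
    define b where "b = p ^ l"
    have "b \<ge> 1" unfolding b_def by (rule pow_pos)
    have refl: "fps_eq_upto b f f" for f :: "complex fps" by (simp add: fps_eq_upto_def)
    have lt: "b < p ^ Suc j" "b < p ^ j * q" if "l \<le> j" for j
    proof -
      have "b \<le> p ^ j" unfolding b_def using that pow_pos(1)[of 1] by (intro power_increasing) auto
      moreover have "p ^ j < p ^ Suc j" "p ^ j < p ^ j * q"
        using prime_gt_1_nat[OF p] prime_gt_1_nat[OF q] pow_pos(1)[of j] by auto
      ultimately show "b < p ^ Suc j" "b < p ^ j * q" by linarith+
    qed
    have "fps_eq_upto b (cyclo_fps j) 1" if "j \<in> S'" for j
    proof -
      have "l < j" using that by (simp add: S'_def)
      hence "b < p ^ j" unfolding b_def using prime_gt_1_nat[OF p] by (intro power_strict_increasing)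
      thus ?thesis
        using cyclo_fps_eq_upto[OF lt, of j] \<open>l < j\<close>
          fps_eq_upto_one_minus_X_power[of b "p ^ j", where ?'a = complex]
        by (auto simp: fps_eq_upto_def)
    qed
    hence "fps_eq_upto b (\<Prod>j\<in>S'. cyclo_fps j) 1" by (rule fps_eq_upto_prod_1)
    moreover have "fps_eq_upto b (cyclo_fps l) (1 - fps_X ^ b)"
      unfolding b_def by (rule cyclo_fps_eq_upto) (use lt[of l] in \<open>auto simp: b_def\<close>)
    ultimately have "fps_eq_upto b (hilbert_fps T)
        (fps_const c * (hilbert_fps (gen2 (p ^ k) q) * ((1 - fps_X ^ b) * 1)))"
      unfolding T_eq by (intro fps_eq_upto_mult refl)
    also have "hilbert_fps (gen2 (p ^ k) q) * ((1 - fps_X ^ b) * 1)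
        = hilbert_fps (gen2 (p ^ k) q) - (fps_X ^ b * hilbert_fps (gen2 (p ^ k) q) :: complex fps)"
      by (simp add: algebra_simps)
    finally have coeffs: "(if m \<in> T then 1 else 0) = c * ((if m \<in> gen2 (p ^ k) q then 1 else 0)
        - (if m < b then 0 else if m - b \<in> gen2 (p ^ k) q then 1 else 0))" if "m \<le> b" for m
      using that by (simp add: fps_eq_upto_def fps_X_power_mult_nth)
    have mem: "m * p ^ k \<in> gen2 (p ^ k) q" for m
      unfolding gen2_iff by (intro exI[of _ m] exI[of _ 0]) simp
    have "c = 1" using coeffs[of 0] T0 mem[of 0] \<open>b \<ge> 1\<close> by simp
    have "p ^ k < b" unfolding b_def using prime_gt_1_nat[OF p] l by (intro power_strict_increasing) auto
    hence "p ^ k \<in> T" using coeffs[of "p ^ k"] mem[of 1] \<open>c = 1\<close> by (auto split: if_splits)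
    have "m * p ^ k \<in> T" for m
      by (induction m) (use T0 T_add \<open>p ^ k \<in> T\<close> in auto)
    moreover have b_eq: "b = p ^ (l - k) * p ^ k" unfolding b_def using l by (simp flip: power_add)
    ultimately have "b \<in> T" by simp
    moreover have "b \<in> gen2 (p ^ k) q" "0 \<in> gen2 (p ^ k) q"
      using mem[of "p ^ (l - k)"] mem[of 0] b_eq by simp_all
    ultimately have False using coeffs[of b] by simp
    thus ?thesis ..
  qed
qed

end

theorem theorem3:
  fixes p q n :: nat and T :: "nat set"
  assumes "prime p" and "prime q" and "p \<noteq> q" and "n > 0"
    and "numerical_semigroup T"
    and "cyclotomic_depth_height T (p ^ n * q) 1"
  shows "T = gen2 (p ^ n) q"
  using semigroup_generated[OF assms(1-3) assms(5,6,4)] .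

end
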